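(* Let $J$ be a finite poset, regarded as a category, and let $\mathbf{C}$ be a category. Assume that: (1) $\mathbf{C}$ is finitely cocomplete; (2) $(\mathcal{L}, \mathcal{R}, \mathsf{fact})$ is a factorisation system on $\mathbf{C}$ (in the sense defined in the context), with $\mathsf{fact} = (F, L, R)$; and (3) every downward closed subset $I \subseteq J$ (with the induced order) is $\mathcal{L}$-faithful. Then every diagram (functor) $X : J \to \mathbf{C}$ has an injectification $(\widehat{X}, \epsilon_X)$. Moreover, this construction is functorial, in that one can choose an injectification $(\widehat{X}, \epsilon_X)$ for every diagram $X : J \to \mathbf{C}$ in such a way that every natural transformation $\alpha : X \Rightarrow Y$ between diagrams $X, Y : J \to \mathbf{C}$ lifts to a commutative square in the functor category $[J, \mathbf{C}]$: there is a natural transformation $\widehat{\alpha} : \widehat{X} \Rightarrow \widehat{Y}$ (with $\widehat{X}, \widehat{Y}$ regarded as functors $J \to \mathbf{C}$) such that $$\epsilon_Y \circ \widehat{\alpha} = \alpha \circ \epsilon_X .$$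
   Context: **Functorial factorisation.** Write $\mathbf{n}$ for the totally ordered set $\{0, \dots, n-1\}$, regarded as a category. A functorial factorisation on a category $\mathbf{C}$ is a functor $\mathsf{fact} : [\mathbf{2}, \mathbf{C}] \to [\mathbf{3}, \mathbf{C}]$ that is a section of the composition functor $d_1 : [\mathbf{3}, \mathbf{C}] \to [\mathbf{2}, \mathbf{C}]$ (which sends a composable pair of morphisms to its composite). One writes $\mathsf{fact} = (F, L, R)$. Each morphism $f : A \to B$ is factored as $A \xrightarrow{Lf} Ff \xrightarrow{Rf} B$ with $Rf \circ Lf = f$. Each commutative square from $f : A \to B$ to $g : C \to D$, given by $a : A \to C$ and $b : B \to D$ with $g \circ a = b \circ f$, functorially induces a morphism $h : Ff \to Fg$ with $h \circ Lf = Lg \circ a$ and $Rg \circ h = b \circ Rf$. **Factorisation system.** Let $\mathcal{L}$ and $\mathcal{R}$ be two classes of morphisms of $\mathbf{C}$, each closed under composition and containing all isomorphisms. They correspond to wide subcategories $\mathbf{C}_{\mathcal{L}}$ and $\mathbf{C}_{\mathcal{R}}$ of $\mathbf{C}$. The triple $(\mathcal{L}, \mathcal{R}, \mathsf{fact})$, with $\mathsf{fact} = (F, L, R)$ a functorial factorisation on $\mathbf{C}$, is called a factorisation system if $Lf \in \mathcal{L}$ and $Rf \in \mathcal{R}$ for every morphism $f$ of $\mathbf{C}$. No orthogonality or lifting condition is required. **Injectification.** Given a functor $X : \mathbf{J} \to \mathbf{C}$, an injectification of $X$ (with respect to $(\mathcal{L}, \mathcal{R})$) is a functor $\widehat{X}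 : \mathbf{J} \to \mathbf{C}_{\mathcal{L}}$ together with a natural transformation $\epsilon$ from the composite $\mathbf{J} \xrightarrow{\widehat{X}} \mathbf{C}_{\mathcal{L}} \hookrightarrow \mathbf{C}$ to $X$, every component of which lies in $\mathcal{R}$. **$\mathcal{L}$-faithfulness.** Let $I$ be a poset and let $G : I \to \mathbf{C}$ be a diagram such that $G i \to G j$ is in $\mathcal{L}$ for all $i \leq j$ in $I$. Such a $G$ is called $\mathcal{L}$-faithful if the colimit inclusions $G i \to \operatorname{colim}_I G$ (colimit taken in $\mathbf{C}$) are also in $\mathcal{L}$ for all $i \in I$. The poset $I$ is called $\mathcal{L}$-faithful if every diagram $G : I \to \mathbf{C}$ all of whose morphisms $G i \to G j$ ($i \leq j$) are in $\mathcal{L}$ is $\mathcal{L}$-faithful. *)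

theory Defs
  imports Main "HOL-Library.FuncSet"
begin

section \<open>Categories, functors, natural transformations\<close>

record ('o, 'm) cat =
  Obj :: "'o set"
  Arr :: "'m set"
  Dom :: "'m \<Rightarrow> 'o"
  Cod :: "'m \<Rightarrow> 'o"
  Ident :: "'o \<Rightarrow> 'm"
  Comp :: "'m \<Rightarrow> 'm \<Rightarrow> 'm"  (infixr "\<cdot>\<index>" 70)

definition hom :: "('o, 'm) cat \<Rightarrow> 'o \<Rightarrow> 'o \<Rightarrow> 'm set" where
  "hom C a b = {f \<in> Arr C. Dom C f = a \<and> Cod C f = b}"

locale category =
  fixes C :: "('o, 'm) cat" (structure)
  assumes Dom_Obj: "f \<in> Arr C \<Longrightarrow> Dom C f \<in> Obj C"
    and Cod_Obj: "f \<in> Arr C \<Longrightarrow> Cod C f \<in> Obj C"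
    and Ident_hom: "a \<in> Obj C \<Longrightarrow> Ident C a \<in> hom C a a"
    and Comp_hom: "f \<in> hom C a b \<Longrightarrow> g \<in> hom C b c \<Longrightarrow> g \<cdot> f \<in> hom C a c"
    and Comp_Ident: "f \<in> hom C a b \<Longrightarrow> f \<cdot> Ident C a = f"
    and Ident_Comp: "f \<in> hom C a b \<Longrightarrow> Ident C b \<cdot> f = f"
    and Comp_assoc: "f \<in> hom C a b \<Longrightarrow> g \<in> hom C b c \<Longrightarrow> h \<in> hom C c d
                       \<Longrightarrow> (h \<cdot> g) \<cdot> f = h \<cdot> (g \<cdot> f)"

definition iso :: "('o, 'm) cat \<Rightarrow> 'm \<Rightarrow> bool" where
  "iso C f \<longleftrightarrow> f \<in> Arr C \<and>
     (\<exists>g \<in> hom C (Cod C f) (Dom C f).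
        g \<cdot>\<^bsub>C\<^esub> f = Ident C (Dom C f) \<and> f \<cdot>\<^bsub>C\<^esub> g = Ident C (Cod C f))"

record ('o, 'm, 'p, 'n) funct =
  FObj :: "'o \<Rightarrow> 'p"
  FArr :: "'m \<Rightarrow> 'n"

text \<open>Both maps of a functor are extensional (\<open>undefined\<close> outside the source category), and so are
  the components of a natural transformation; hence HOL equality is the mathematical equality.\<close>

definition functors ::
    "('o, 'm) cat \<Rightarrow> ('p, 'n) cat \<Rightarrow> ('o, 'm, 'p, 'n) funct set" where
  "functors A B = {F.
     FObj F \<in> Obj A \<rightarrow>\<^sub>E Obj B \<and> FArr F \<in> Arr A \<rightarrow>\<^sub>E Arr B \<and>
     (\<forall>f \<in> Arr A. FArr F f \<in> hom B (FObj F (Dom A f)) (FObj F (Cod A f))) \<and>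
     (\<forall>a \<in> Obj A. FArr F (Ident A a) = Ident B (FObj F a)) \<and>
     (\<forall>f \<in> Arr A. \<forall>g \<in> Arr A. Dom A g = Cod A f \<longrightarrow>
        FArr F (g \<cdot>\<^bsub>A\<^esub> f) = FArr F g \<cdot>\<^bsub>B\<^esub> FArr F f)}"

definition id_funct :: "('o, 'm) cat \<Rightarrow> ('o, 'm, 'o, 'm) funct" where
  "id_funct A = \<lparr>FObj = (\<lambda>a\<in>Obj A. a), FArr = (\<lambda>f\<in>Arr A. f)\<rparr>"

text \<open>\<open>comp_funct A G F\<close> is the composite of \<open>F\<close> followed by \<open>G\<close>, where \<open>A\<close> is the source of \<open>F\<close>.\<close>

definition comp_funct :: "('o, 'm) cat \<Rightarrow> ('p, 'n, 'q, 'k) funct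
    \<Rightarrow> ('o, 'm, 'p, 'n) funct \<Rightarrow> ('o, 'm, 'q, 'k) funct" where
  "comp_funct A G F =
     \<lparr>FObj = (\<lambda>a\<in>Obj A. FObj G (FObj F a)), FArr = (\<lambda>f\<in>Arr A. FArr G (FArr F f))\<rparr>"

record ('o, 'm, 'p, 'n) nattrans =
  Source :: "('o, 'm, 'p, 'n) funct"
  Target :: "('o, 'm, 'p, 'n) funct"
  Component :: "'o \<Rightarrow> 'n"

definition nattranses :: "('o, 'm) cat \<Rightarrow> ('p, 'n) cat \<Rightarrow> ('o, 'm, 'p, 'n) nattrans set" where
  "nattranses A B = {t.
     Source t \<in> functors A B \<and> Target t \<in> functors A B \<and>
     Component t \<in> Obj A \<rightarrow>\<^sub>E Arr B \<and>
     (\<forall>a \<in> Obj A. Component t a \<in> hom B (FObj (Source t) a) (FObj (Target t) a)) \<and>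
     (\<forall>f \<in> Arr A. Component t (Cod A f) \<cdot>\<^bsub>B\<^esub> FArr (Source t) f
                    = FArr (Target t) f \<cdot>\<^bsub>B\<^esub> Component t (Dom A f))}"

definition functor_cat :: "('o, 'm) cat \<Rightarrow> ('p, 'n) cat
    \<Rightarrow> (('o, 'm, 'p, 'n) funct, ('o, 'm, 'p, 'n) nattrans) cat" where
  "functor_cat A B =
     \<lparr>Obj = functors A B, Arr = nattranses A B, Dom = Source, Cod = Target,
      Ident = (\<lambda>F. \<lparr>Source = F, Target = F, Component = (\<lambda>a\<in>Obj A. Ident B (FObj F a))\<rparr>),
      Comp = (\<lambda>t s. \<lparr>Source = Source s, Target = Target t,
                     Component = (\<lambda>a\<in>Obj A. Component t a \<cdot>\<^bsub>B\<^esub> Component s a)\<rparr>)\<rparr>"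

lemma functor_cat_simps [simp]:
  "Obj (functor_cat A B) = functors A B"
  "Arr (functor_cat A B) = nattranses A B"
  "Dom (functor_cat A B) = Source"
  "Cod (functor_cat A B) = Target"
  "Ident (functor_cat A B) F = \<lparr>Source = F, Target = F, Component = (\<lambda>a\<in>Obj A. Ident B (FObj F a))\<rparr>"
  "t \<cdot>\<^bsub>functor_cat A B\<^esub> s = \<lparr>Source = Source s, Target = Target t,
     Component = (\<lambda>a\<in>Obj A. Component t a \<cdot>\<^bsub>B\<^esub> Component s a)\<rparr>"
  by (simp_all add: functor_cat_def)

lemma hom_functor_cat:
  "t \<in> hom (functor_cat A B) F G \<longleftrightarrow> t \<in> nattranses A B \<and> Source t = F \<and> Target t = G"
  by (simp add: hom_def)

lemma category_functor_cat:
  assumes A: "category A" and B: "category B"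
  shows "category (functor_cat A B)"
proof -
  interpret A: category A by (rule A)
  interpret B: category B by (rule B)
  have FH: "FArr F f \<in> hom B (FObj F (Dom A f)) (FObj F (Cod A f))"
    if "F \<in> functors A B" "f \<in> Arr A" for F f
    using that by (auto simp: functors_def)
  have FO: "FObj F a \<in> Obj B" if "F \<in> functors A B" "a \<in> Obj A" for F a
    using that by (auto simp: functors_def)
  have CH: "Component t a \<in> hom B (FObj (Source t) a) (FObj (Target t) a)"
    if "t \<in> nattranses A B" "a \<in> Obj A" for t a
    using that by (auto simp: nattranses_def)
  have N: "Component t (Cod A f) \<cdot>\<^bsub>B\<^esub> FArr (Source t) f
             = FArr (Target t) f \<cdot>\<^bsub>B\<^esub> Component t (Dom A f)"
    if "t \<in> nattranses A B" "f \<in> Arr A" for t f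
    using that by (auto simp: nattranses_def)
  have ext: "Component t = restrict (Component t) (Obj A)" if "t \<in> nattranses A B" for t
    using that by (auto simp: nattranses_def extensional_restrict PiE_def)
  have hd: "f \<in> Arr B \<and> Dom B f = a \<and> Cod B f = b" if "f \<in> hom B a b" for f a b
    using that by (auto simp: hom_def)
  show ?thesis
  proof (unfold_locales, goal_cases)
    case (1 f) then show ?case by (auto simp: nattranses_def)
  next
    case (2 f) then show ?case by (auto simp: nattranses_def)
  next
    case (3 F)
    then have F: "F \<in> functors A B" by simp
    have I: "Ident B (FObj F a) \<in> hom B (FObj F a) (FObj F a)" if "a \<in> Obj A" for a
      by (rule B.Ident_hom[OF FO[OF F that]])
    then show ?case
      using F B.Comp_Ident[OF FH[OF F]] B.Ident_Comp[OF FH[OF F]] hd[OF I]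
      by (simp add: hom_functor_cat nattranses_def A.Dom_Obj A.Cod_Obj)
  next
    case (4 s F G t H)
    then have s: "s \<in> nattranses A B" "Source s = F" "Target s = G"
      and t: "t \<in> nattranses A B" "Source t = G" "Target t = H"
      by (auto simp: hom_functor_cat)
    have c: "Component t a \<cdot>\<^bsub>B\<^esub> Component s a \<in> hom B (FObj F a) (FObj H a)" if "a \<in> Obj A" for a
      using B.Comp_hom CH[OF s(1) that] CH[OF t(1) that] s t by auto
    have n: "(Component t (Cod A f) \<cdot>\<^bsub>B\<^esub> Component s (Cod A f)) \<cdot>\<^bsub>B\<^esub> FArr F f
        = FArr H f \<cdot>\<^bsub>B\<^esub> (Component t (Dom A f) \<cdot>\<^bsub>B\<^esub> Component s (Dom A f))"
      if f: "f \<in> Arr A" for f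
    proof -
      have st: "F \<in> functors A B" "G \<in> functors A B" "H \<in> functors A B"
        using s t by (auto simp: nattranses_def)
      note h = FH[OF st(1) f] FH[OF st(2) f] FH[OF st(3) f]
        CH[OF s(1) A.Dom_Obj[OF f], unfolded s] CH[OF s(1) A.Cod_Obj[OF f], unfolded s]
        CH[OF t(1) A.Dom_Obj[OF f], unfolded t] CH[OF t(1) A.Cod_Obj[OF f], unfolded t]
      show ?thesis
        using B.Comp_assoc[OF h(1,5,7)] B.Comp_assoc[OF h(4,2,7)] B.Comp_assoc[OF h(4,6,3)]
          N[OF s(1) f] N[OF t(1) f] s t by simp
    qed
    have "F \<in> functors A B" "H \<in> functors A B" using s t by (auto simp: nattranses_def)
    then show ?case
      using s t c n hd[OF c] by (simp add: hom_functor_cat nattranses_def A.Dom_Obj A.Cod_Obj)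
  next
    case (5 s F G)
    then have s: "s \<in> nattranses A B" "Source s = F" "Target s = G"
      by (auto simp: hom_functor_cat)
    have "(\<lambda>a\<in>Obj A. Component s a \<cdot>\<^bsub>B\<^esub> (\<lambda>a\<in>Obj A. Ident B (FObj F a)) a) = Component s"
      by (subst (2) ext[OF s(1)]) (use s(2,3)[symmetric] in \<open>auto intro!: restrict_ext B.Comp_Ident[OF CH[OF s(1)]]\<close>)
    then show ?case using s by simp
  next
    case (6 s F G)
    then have s: "s \<in> nattranses A B" "Source s = F" "Target s = G"
      by (auto simp: hom_functor_cat)
    have "(\<lambda>a\<in>Obj A. (\<lambda>a\<in>Obj A. Ident B (FObj G a)) a \<cdot>\<^bsub>B\<^esub> Component s a) = Component s"
      by (subst (2) ext[OF s(1)]) (use s(2,3)[symmetric] in \<open>auto intro!: restrict_ext B.Ident_Comp[OF CH[OF s(1)]]\<close>)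
    then show ?case using s by simp
  next
    case (7 s F G t H u K)
    then have s: "s \<in> nattranses A B" "Source s = F" "Target s = G"
      and t: "t \<in> nattranses A B" "Source t = G" "Target t = H"
      and u: "u \<in> nattranses A B" "Source u = H" "Target u = K"
      by (auto simp: hom_functor_cat)
    show ?case
      by (auto intro!: restrict_ext
          B.Comp_assoc[OF CH[OF s(1), unfolded s] CH[OF t(1), unfolded t] CH[OF u(1), unfolded u]])
  qed
qed

text \<open>Precomposition with \<open>K : A \<rightarrow> B\<close>, as a functor from \<open>[B, C]\<close> to \<open>[A, C]\<close>.\<close>

definition precomp_funct :: "('o, 'm) cat \<Rightarrow> ('p, 'n) cat \<Rightarrow> ('q, 'k) cat
    \<Rightarrow> ('o, 'm, 'p, 'n) funct
    \<Rightarrow> (('p, 'n, 'q, 'k) funct, ('p, 'n, 'q, 'k) nattrans,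
        ('o, 'm, 'q, 'k) funct, ('o, 'm, 'q, 'k) nattrans) funct" where
  "precomp_funct A B C K =
     \<lparr>FObj = (\<lambda>F\<in>functors B C. comp_funct A F K),
      FArr = (\<lambda>t\<in>nattranses B C.
                \<lparr>Source = comp_funct A (Source t) K, Target = comp_funct A (Target t) K,
                 Component = (\<lambda>a\<in>Obj A. Component t (FObj K a))\<rparr>)\<rparr>"


section \<open>Posets as categories\<close>

text \<open>The order on the set \<open>I\<close> is the one induced from the ambient type.\<close>

definition poset_cat :: "'j::order set \<Rightarrow> ('j, 'j \<times> 'j) cat" where
  "poset_cat I =
     \<lparr>Obj = I, Arr = {(i, j). i \<in> I \<and> j \<in> I \<and> i \<le> j}, Dom = fst, Cod = snd,
      Ident = (\<lambda>i. (i, i)), Comp = (\<lambda>v u. (fst u, snd v))\<rparr>"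

lemma category_poset_cat: "category (poset_cat I)"
  by unfold_locales (auto simp: poset_cat_def hom_def)

abbreviation ord_cat :: "nat \<Rightarrow> (nat, nat \<times> nat) cat" where
  "ord_cat n \<equiv> poset_cat {0..<n}"


section \<open>Colimits\<close>

definition cocone :: "('o, 'm) cat \<Rightarrow> ('p, 'n) cat \<Rightarrow> ('o, 'm, 'p, 'n) funct
    \<Rightarrow> 'p \<Rightarrow> ('o \<Rightarrow> 'n) \<Rightarrow> bool" where
  "cocone D C G c \<iota> \<longleftrightarrow> c \<in> Obj C \<and>
     (\<forall>i \<in> Obj D. \<iota> i \<in> hom C (FObj G i) c) \<and>
     (\<forall>u \<in> Arr D. \<iota> (Cod D u) \<cdot>\<^bsub>C\<^esub> FArr G u = \<iota> (Dom D u))"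

definition colimit :: "('o, 'm) cat \<Rightarrow> ('p, 'n) cat \<Rightarrow> ('o, 'm, 'p, 'n) funct
    \<Rightarrow> 'p \<Rightarrow> ('o \<Rightarrow> 'n) \<Rightarrow> bool" where
  "colimit D C G c \<iota> \<longleftrightarrow> cocone D C G c \<iota> \<and>
     (\<forall>d \<kappa>. cocone D C G d \<kappa> \<longrightarrow>
        (\<exists>!h. h \<in> hom C c d \<and> (\<forall>i \<in> Obj D. h \<cdot>\<^bsub>C\<^esub> \<iota> i = \<kappa> i)))"

text \<open>Every finite category is isomorphic to one whose objects and arrows are natural numbers, so
  it suffices to let the index categories range over those.\<close>

definition finitely_cocomplete :: "('o, 'm) cat \<Rightarrow> bool" where
  "finitely_cocomplete C \<longleftrightarrow>
     (\<forall>(D :: (nat, nat) cat) G.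
        category D \<and> finite (Obj D) \<and> finite (Arr D) \<and> G \<in> functors D C \<longrightarrow>
        (\<exists>c \<iota>. colimit D C G c \<iota>))"


section \<open>Factorisation systems\<close>

text \<open>The composition functor \<open>[3, C] \<rightarrow> [2, C]\<close> is precomposition with the order embedding of
  \<open>2\<close> into \<open>3\<close> that omits \<open>1\<close>.\<close>

definition skip1 :: "(nat, nat \<times> nat, nat, nat \<times> nat) funct" where
  "skip1 = \<lparr>FObj = (\<lambda>i\<in>{0..<2}. 2 * i), FArr = (\<lambda>(i, j)\<in>Arr (ord_cat 2). (2 * i, 2 * j))\<rparr>"

abbreviation arrow_cat where "arrow_cat C \<equiv> functor_cat (ord_cat 2) C"
abbreviation pair_cat where "pair_cat C \<equiv> functor_cat (ord_cat 3) C"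

definition d1 where "d1 C = precomp_funct (ord_cat 2) (ord_cat 3) C skip1"

type_synonym ('o, 'm) factor =
  "((nat, nat \<times> nat, 'o, 'm) funct, (nat, nat \<times> nat, 'o, 'm) nattrans,
    (nat, nat \<times> nat, 'o, 'm) funct, (nat, nat \<times> nat, 'o, 'm) nattrans) funct"

definition functorial_factorisation :: "('o, 'm) cat \<Rightarrow> ('o, 'm) factor \<Rightarrow> bool" where
  "functorial_factorisation C \<Phi> \<longleftrightarrow>
     \<Phi> \<in> functors (arrow_cat C) (pair_cat C) \<and>
     comp_funct (arrow_cat C) (d1 C) \<Phi> = id_funct (arrow_cat C)"

text \<open>The arrow \<open>f\<close> regarded as an object of \<open>[2, C]\<close>.\<close>

definition arrow_funct :: "('o, 'm) cat \<Rightarrow> 'm \<Rightarrow> (nat, nat \<times> nat, 'o, 'm) funct" where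
  "arrow_funct C f =
     \<lparr>FObj = (\<lambda>i\<in>{0..<2}. if i = 0 then Dom C f else Cod C f),
      FArr = (\<lambda>(i, j)\<in>Arr (ord_cat 2).
                if j = 0 then Ident C (Dom C f) else if i = 0 then f else Ident C (Cod C f))\<rparr>"

definition fact_F :: "('o, 'm) cat \<Rightarrow> ('o, 'm) factor \<Rightarrow> 'm \<Rightarrow> 'o" where
  "fact_F C \<Phi> f = FObj (FObj \<Phi> (arrow_funct C f)) 1"

definition fact_L :: "('o, 'm) cat \<Rightarrow> ('o, 'm) factor \<Rightarrow> 'm \<Rightarrow> 'm" where
  "fact_L C \<Phi> f = FArr (FObj \<Phi> (arrow_funct C f)) (0, 1)"

definition fact_R :: "('o, 'm) cat \<Rightarrow> ('o, 'm) factor \<Rightarrow> 'm \<Rightarrow> 'm" where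
  "fact_R C \<Phi> f = FArr (FObj \<Phi> (arrow_funct C f)) (1, 2)"

lemma arrow_funct_functors:
  assumes "category C" "f \<in> Arr C"
  shows "arrow_funct C f \<in> functors (ord_cat 2) C"
proof -
  interpret category C by (rule assms)
  have o: "Dom C f \<in> Obj C" "Cod C f \<in> Obj C" and f: "f \<in> hom C (Dom C f) (Cod C f)"
    using assms Dom_Obj Cod_Obj by (auto simp: hom_def)
  note i = Ident_hom[OF o(1)] Ident_hom[OF o(2)]
  have A: "Arr (ord_cat 2) = {(0,0), (0,1), (1,1)}" by (auto simp: poset_cat_def)
  have O: "{0..<2::nat} = {0, 1}" by auto
  show ?thesis
    using i f o Comp_Ident[OF f] Ident_Comp[OF f] Comp_Ident[OF i(1)] Comp_Ident[OF i(2)]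
    by (simp add: functors_def arrow_funct_def A O, simp add: poset_cat_def O)
      (auto simp: hom_def)
qed

lemma fact_L_R:
  assumes "category C" "functorial_factorisation C \<Phi>" "f \<in> Arr C"
  shows "fact_L C \<Phi> f \<in> hom C (Dom C f) (fact_F C \<Phi> f)"
    and "fact_R C \<Phi> f \<in> hom C (fact_F C \<Phi> f) (Cod C f)"
    and "fact_R C \<Phi> f \<cdot>\<^bsub>C\<^esub> fact_L C \<Phi> f = f"
proof -
  let ?a = "arrow_funct C f" and ?P = "FObj \<Phi> (arrow_funct C f)"
  have a: "?a \<in> functors (ord_cat 2) C" using assms by (simp add: arrow_funct_functors)
  have P: "?P \<in> functors (ord_cat 3) C"
    using assms(2) a unfolding functorial_factorisation_def functors_def[of "arrow_cat C"] by auto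
  have "FObj (comp_funct (arrow_cat C) (d1 C) \<Phi>) ?a = FObj (id_funct (arrow_cat C)) ?a"
    using assms(2) by (simp add: functorial_factorisation_def)
  then have e: "comp_funct (ord_cat 2) ?P skip1 = ?a"
    using a P by (simp add: comp_funct_def[of "arrow_cat C"] id_funct_def d1_def precomp_funct_def)
  have "FObj (comp_funct (ord_cat 2) ?P skip1) 0 = Dom C f"
       "FObj (comp_funct (ord_cat 2) ?P skip1) 1 = Cod C f"
       "FArr (comp_funct (ord_cat 2) ?P skip1) (0,1) = f"
    unfolding e by (simp_all add: arrow_funct_def poset_cat_def)
  then have v: "FObj ?P 0 = Dom C f" "FObj ?P 2 = Cod C f" "FArr ?P (0,2) = f"
    by (simp_all add: comp_funct_def skip1_def poset_cat_def)
  have h: "FArr ?P (i, j) \<in> hom C (FObj ?P i) (FObj ?P j)" if "i \<le> j" "j < 3" for i j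
  proof -
    have "(i, j) \<in> Arr (ord_cat 3)" using that by (simp add: poset_cat_def)
    moreover have "\<forall>u \<in> Arr (ord_cat 3). FArr ?P u \<in> hom C (FObj ?P (fst u)) (FObj ?P (snd u))"
      using P by (simp add: functors_def poset_cat_def)
    ultimately show ?thesis by fastforce
  qed
  have c: "FArr ?P (0, 2) = FArr ?P (1, 2) \<cdot>\<^bsub>C\<^esub> FArr ?P (0, 1)"
  proof -
    have "(0, 1) \<in> Arr (ord_cat 3)" "(1, 2) \<in> Arr (ord_cat 3)" by (simp_all add: poset_cat_def)
    moreover have "\<forall>u \<in> Arr (ord_cat 3). \<forall>v \<in> Arr (ord_cat 3). Dom (ord_cat 3) v = Cod (ord_cat 3) u
        \<longrightarrow> FArr ?P (v \<cdot>\<^bsub>ord_cat 3\<^esub> u) = FArr ?P v \<cdot>\<^bsub>C\<^esub> FArr ?P u"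
      using P unfolding functors_def by blast
    moreover have "(1, 2) \<cdot>\<^bsub>ord_cat 3\<^esub> (0, 1) = (0, 2)"
      "Dom (ord_cat 3) (1, 2) = Cod (ord_cat 3) (0, 1)" by (simp_all add: poset_cat_def)
    ultimately show ?thesis by metis
  qed
  show "fact_L C \<Phi> f \<in> hom C (Dom C f) (fact_F C \<Phi> f)"
    using h[of 0 1] v by (simp add: fact_L_def fact_F_def)
  show "fact_R C \<Phi> f \<in> hom C (fact_F C \<Phi> f) (Cod C f)"
    using h[of 1 2] v by (simp add: fact_R_def fact_F_def)
  show "fact_R C \<Phi> f \<cdot>\<^bsub>C\<^esub> fact_L C \<Phi> f = f"
    using c v by (simp add: fact_R_def fact_L_def)
qed

definition wide_class :: "('o, 'm) cat \<Rightarrow> 'm set \<Rightarrow> bool" where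
  "wide_class C M \<longleftrightarrow> M \<subseteq> Arr C \<and> (\<forall>f. iso C f \<longrightarrow> f \<in> M) \<and>
     (\<forall>f \<in> M. \<forall>g \<in> M. Dom C g = Cod C f \<longrightarrow> g \<cdot>\<^bsub>C\<^esub> f \<in> M)"

definition factorisation_system ::
    "('o, 'm) cat \<Rightarrow> 'm set \<Rightarrow> 'm set \<Rightarrow> ('o, 'm) factor \<Rightarrow> bool" where
  "factorisation_system C L R \<Phi> \<longleftrightarrow>
     wide_class C L \<and> wide_class C R \<and> functorial_factorisation C \<Phi> \<and>
     (\<forall>f \<in> Arr C. fact_L C \<Phi> f \<in> L \<and> fact_R C \<Phi> f \<in> R)"

definition wide_subcat :: "('o, 'm) cat \<Rightarrow> 'm set \<Rightarrow> ('o, 'm) cat" where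
  "wide_subcat C M = C\<lparr>Arr := M\<rparr>"

definition inclusion :: "('o, 'm) cat \<Rightarrow> 'm set \<Rightarrow> ('o, 'm, 'o, 'm) funct" where
  "inclusion C M = \<lparr>FObj = (\<lambda>a\<in>Obj C. a), FArr = (\<lambda>f\<in>M. f)\<rparr>"

lemma category_wide_subcat:
  assumes "category C" "wide_class C M"
  shows "category (wide_subcat C M)" "inclusion C M \<in> functors (wide_subcat C M) C"
proof -
  interpret category C by (rule assms)
  have M: "f \<in> M \<Longrightarrow> f \<in> Arr C" for f using assms(2) by (auto simp: wide_class_def)
  have h: "f \<in> hom (wide_subcat C M) a b \<longleftrightarrow> f \<in> M \<and> f \<in> hom C a b" for f a b
    using M by (auto simp: hom_def wide_subcat_def)
  have I: "Ident C a \<in> M" if "a \<in> Obj C" for a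
  proof -
    have "iso C (Ident C a)"
      using Ident_hom[OF that] Comp_Ident[OF Ident_hom[OF that]] by (auto simp: iso_def hom_def)
    then show ?thesis using assms(2) by (auto simp: wide_class_def)
  qed
  have c: "g \<cdot>\<^bsub>C\<^esub> f \<in> M" if "f \<in> M" "g \<in> M" "Dom C g = Cod C f" for f g
    using assms(2) that by (auto simp: wide_class_def)
  have sel: "Obj (wide_subcat C M) = Obj C" "Arr (wide_subcat C M) = M"
    "Dom (wide_subcat C M) = Dom C" "Cod (wide_subcat C M) = Cod C"
    "Ident (wide_subcat C M) = Ident C" "Comp (wide_subcat C M) = Comp C"
    by (simp_all add: wide_subcat_def)
  have hd: "f \<in> hom C a b \<Longrightarrow> Dom C f = a \<and> Cod C f = b" for f a b
    by (simp add: hom_def)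
  show "category (wide_subcat C M)"
  proof (unfold_locales, unfold h sel, goal_cases)
    case (4 f a b g c') then show ?case using c[of f g] Comp_hom[of f a b g c'] hd by metis
  qed (use Comp_Ident Ident_Comp Comp_assoc in \<open>auto simp: M Dom_Obj Cod_Obj I Ident_hom\<close>)
  show "inclusion C M \<in> functors (wide_subcat C M) C"
    unfolding functors_def inclusion_def sel using M I c by (simp add: hom_def Dom_Obj Cod_Obj)
qed


section \<open>Injectifications and faithfulness\<close>

definition injectification :: "('j, 'i) cat \<Rightarrow> ('o, 'm) cat \<Rightarrow> 'm set \<Rightarrow> 'm set
    \<Rightarrow> ('j, 'i, 'o, 'm) funct \<Rightarrow> ('j, 'i, 'o, 'm) funct \<Rightarrow> ('j, 'i, 'o, 'm) nattrans \<Rightarrow> bool" where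
  "injectification J C L R X X' \<epsilon> \<longleftrightarrow>
     X' \<in> functors J (wide_subcat C L) \<and>
     \<epsilon> \<in> hom (functor_cat J C) (comp_funct J (inclusion C L) X') X \<and>
     (\<forall>j \<in> Obj J. Component \<epsilon> j \<in> R)"

text \<open>The colimit is only determined up to isomorphism, so the condition is imposed on every
  colimiting cocone; existence of a colimit is part of the notion.\<close>

definition faithful_diagram :: "('o, 'm) cat \<Rightarrow> 'm set \<Rightarrow> 'j::order set
    \<Rightarrow> ('j, 'j \<times> 'j, 'o, 'm) funct \<Rightarrow> bool" where
  "faithful_diagram C L I G \<longleftrightarrow>
     (\<exists>c \<iota>. colimit (poset_cat I) C G c \<iota>) \<and>
     (\<forall>c \<iota>. colimit (poset_cat I) C G c \<iota> \<longrightarrow> (\<forall>i \<in> I. \<iota> i \<in> L))"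

definition faithful_poset :: "('o, 'm) cat \<Rightarrow> 'm set \<Rightarrow> 'j::order set \<Rightarrow> bool" where
  "faithful_poset C L I \<longleftrightarrow>
     (\<forall>G \<in> functors (poset_cat I) C.
        (\<forall>i \<in> I. \<forall>j \<in> I. i \<le> j \<longrightarrow> FArr G (i, j) \<in> L) \<longrightarrow> faithful_diagram C L I G)"

end

theory Submission
  imports Defs
begin

text \<open>The object at \<open>j\<close> is found by well-founded recursion: with the diagram on the elements below
  \<open>j\<close> already replaced, factor the map from its colimit to \<open>X j\<close>. The transition maps into the new
  object are colimit inclusions, which lie in \<open>L\<close> by faithfulness, followed by the \<open>L\<close>-part of
  that factorisation. A natural transformation lifts by the same recursion, through the maps it
  induces on colimits and functoriality of the factorisation.\<close>

section \<open>Functorial factorisation applied to commutative squares\<close>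

text \<open>The square is an arrow \<open>t\<close> of \<open>arrow_cat C\<close>, so
  \<open>\<Phi>\<close> sends it to a transformation \<open>T\<close> between the two
  factorisations. The section equation forces the outer components of \<open>T\<close> to be
  \<open>u\<close> and \<open>v\<close>; the middle one is \<open>w\<close>, and its two equations
  are naturality of \<open>T\<close> at \<open>(0, 1)\<close> and \<open>(1, 2)\<close>.\<close>

lemma fact_square:
  assumes "category C" and "functorial_factorisation C \<Phi>"
    and f: "f \<in> hom C a b" and g: "g \<in> hom C c d"
    and u: "u \<in> hom C a c" and v: "v \<in> hom C b d"
    and comm: "g \<cdot>\<^bsub>C\<^esub> u = v \<cdot>\<^bsub>C\<^esub> f"
  obtains w where "w \<in> hom C (fact_F C \<Phi> f) (fact_F C \<Phi> g)"
    and "w \<cdot>\<^bsub>C\<^esub> fact_L C \<Phi> f = fact_L C \<Phi> g \<cdot>\<^bsub>C\<^esub> u"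
    and "fact_R C \<Phi> g \<cdot>\<^bsub>C\<^esub> w = v \<cdot>\<^bsub>C\<^esub> fact_R C \<Phi> f"
proof -
  interpret category C by fact
  define t where "t = \<lparr>Source = arrow_funct C f, Target = arrow_funct C g,
    Component = (\<lambda>i\<in>{0..<2::nat}. if i = 0 then u else v)\<rparr>"
  define T where "T = FArr \<Phi> t"
  have fs: "arrow_funct C f \<in> functors (ord_cat 2) C" "arrow_funct C g \<in> functors (ord_cat 2) C"
    using f g \<open>category C\<close> by (auto intro!: arrow_funct_functors simp: hom_def)
  have arr2: "Arr (ord_cat 2) = {(0,0), (0,1), (1,1)}" by (auto simp: poset_cat_def)
  have obj2: "Obj (ord_cat 2) = {0, 1}" by (auto simp: poset_cat_def)
  have DC: "Dom (ord_cat 2) = fst" "Cod (ord_cat 2) = snd" by (simp_all add: poset_cat_def)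
  have ends: "Dom C f = a" "Cod C f = b" "Dom C g = c" "Cod C g = d"
    "u \<in> Arr C" "v \<in> Arr C"
    using f g u v by (auto simp: hom_def)
  have val_f: "FObj (arrow_funct C f) 0 = a" "FObj (arrow_funct C f) 1 = b"
    "FArr (arrow_funct C f) (0, 0) = Ident C a" "FArr (arrow_funct C f) (0, 1) = f"
    "FArr (arrow_funct C f) (1, 1) = Ident C b"
    by (simp_all add: arrow_funct_def arr2 ends)
  have val_g: "FObj (arrow_funct C g) 0 = c" "FObj (arrow_funct C g) 1 = d"
    "FArr (arrow_funct C g) (0, 0) = Ident C c" "FArr (arrow_funct C g) (0, 1) = g"
    "FArr (arrow_funct C g) (1, 1) = Ident C d"
    by (simp_all add: arrow_funct_def arr2 ends)
  have st: "Source t = arrow_funct C f" "Target t = arrow_funct C g"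
    and comps: "Component t 0 = u" "Component t 1 = v"
    by (simp_all add: t_def)
  have ext: "Component t \<in> extensional {0, 1}"
    by (auto simp: t_def extensional_def)
  have t: "t \<in> nattranses (ord_cat 2) C"
    using fs ends u v comm Comp_Ident[OF u] Ident_Comp[OF u] Comp_Ident[OF v] Ident_Comp[OF v]
      val_f val_g comps ext st
    by (simp add: nattranses_def obj2 arr2 DC PiE_def)
  have \<Phi>: "\<Phi> \<in> functors (arrow_cat C) (pair_cat C)"
    and sec: "comp_funct (arrow_cat C) (d1 C) \<Phi> = id_funct (arrow_cat C)"
    using assms(2) by (auto simp: functorial_factorisation_def)
  have T: "T \<in> nattranses (ord_cat 3) C"
    "Source T = FObj \<Phi> (arrow_funct C f)" "Target T = FObj \<Phi> (arrow_funct C g)"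
  proof -
    have "FArr \<Phi> t \<in> hom (pair_cat C) (FObj \<Phi> (Source t)) (FObj \<Phi> (Target t))"
      using \<Phi> t unfolding functors_def[of "arrow_cat C"] by auto
    then show "T \<in> nattranses (ord_cat 3) C"
      "Source T = FObj \<Phi> (arrow_funct C f)" "Target T = FObj \<Phi> (arrow_funct C g)"
      by (simp_all add: hom_functor_cat T_def t_def)
  qed
  have "FArr (comp_funct (arrow_cat C) (d1 C) \<Phi>) t = FArr (id_funct (arrow_cat C)) t"
    using sec by simp
  then have "\<lparr>Source = comp_funct (ord_cat 2) (Source T) skip1,
      Target = comp_funct (ord_cat 2) (Target T) skip1,
      Component = (\<lambda>i\<in>Obj (ord_cat 2). Component T (FObj skip1 i))\<rparr> = t"
    using t T by (simp add: comp_funct_def[of "arrow_cat C"] id_funct_def d1_def precomp_funct_def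
        T_def[symmetric])
  from arg_cong[OF this, of Component]
  have eq: "(\<lambda>i\<in>Obj (ord_cat 2). Component T (FObj skip1 i)) = Component t"
    by simp
  have "Component T (FObj skip1 0) = Component t 0" "Component T (FObj skip1 1) = Component t 1"
    using fun_cong[OF eq, of 0] fun_cong[OF eq, of 1] by (simp_all add: obj2)
  \<comment> \<open>\<open>skip1\<close> doubles indices, so the section equation reads
    \<open>T\<close> at 0 and 2 only and leaves the component at 1 undetermined.\<close>
  then have T02: "Component T 0 = u" "Component T 2 = v"
    by (simp_all add: skip1_def t_def)
  have nat: "Component T j \<cdot>\<^bsub>C\<^esub> FArr (Source T) (i, j) = FArr (Target T) (i, j) \<cdot>\<^bsub>C\<^esub> Component T i"
    if "i \<le> j" "j < 3" for i j
  proof -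
    have "(i, j) \<in> Arr (ord_cat 3)" using that by (simp add: poset_cat_def)
    moreover have "\<forall>h \<in> Arr (ord_cat 3). Component T (snd h) \<cdot>\<^bsub>C\<^esub> FArr (Source T) h
        = FArr (Target T) h \<cdot>\<^bsub>C\<^esub> Component T (fst h)"
      using T(1) by (simp add: nattranses_def poset_cat_def)
    ultimately show ?thesis by fastforce
  qed
  have "1 \<in> Obj (ord_cat 3)" by (simp add: poset_cat_def)
  then have "Component T 1 \<in> hom C (FObj (Source T) 1) (FObj (Target T) 1)"
    using T(1) unfolding nattranses_def by blast
  then show thesis
    using that[of "Component T 1"] nat[of 0 1] nat[of 1 2] T02 T(2,3)
    by (simp add: fact_F_def fact_L_def fact_R_def)
qed

text \<open>The value of an injectification at one index: the object, its map to the given diagram, and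
  the transition maps from the objects at strictly smaller indices.\<close>

record ('j, 'o, 'm) stage =
  ob :: 'o
  proj :: 'm
  link :: "'j \<Rightarrow> 'm"

section \<open>Diagrams and cocones over posets\<close>

text \<open>\<open>link\<close> is meant for strictly smaller indices only, so identities are
  supplied separately on the diagonal. With \<open>I\<close> as a parameter the same formula
  describes both the partial diagram below an index and the finished diagram on
  \<open>J\<close>.\<close>

definition stage_diagram ::
    "('o, 'm) cat \<Rightarrow> ('j \<Rightarrow> ('j, 'o, 'm) stage) \<Rightarrow> 'j::order set \<Rightarrow> ('j, 'j \<times> 'j, 'o, 'm) funct" where
  "stage_diagram C f I = \<lparr>FObj = (\<lambda>i\<in>I. ob (f i)),
     FArr = (\<lambda>(i, k)\<in>Arr (poset_cat I). if i = k then Ident C (ob (f i)) else link (f k) i)\<rparr>"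

lemma stage_diagram_simps:
  "i \<in> I \<Longrightarrow> FObj (stage_diagram C f I) i = ob (f i)"
  "i \<in> I \<Longrightarrow> k \<in> I \<Longrightarrow> i \<le> k \<Longrightarrow> FArr (stage_diagram C f I) (i, k) =
     (if i = k then Ident C (ob (f i)) else link (f k) i)"
  by (simp_all add: stage_diagram_def poset_cat_def)

text \<open>Supplies the locality that well-founded choice demands of \<open>is_stage\<close> in
  \<open>stages_exist\<close>.\<close>

lemma stage_diagram_cong:
  "(\<And>i. i \<in> I \<Longrightarrow> f i = g i) \<Longrightarrow> stage_diagram C f I = stage_diagram C g I"
  by (auto simp: stage_diagram_def poset_cat_def intro!: restrict_ext)

lemma functors_wide_subcat:
  assumes "G \<in> functors A C" and "\<And>u. u \<in> Arr A \<Longrightarrow> FArr G u \<in> M"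
  shows "G \<in> functors A (wide_subcat C M)"
  using assms by (simp add: functors_def wide_subcat_def hom_def PiE_def)

lemma cocone_poset_cat:
  "cocone (poset_cat I) C G c \<iota> \<longleftrightarrow> c \<in> Obj C \<and> (\<forall>i\<in>I. \<iota> i \<in> hom C (FObj G i) c) \<and>
     (\<forall>i\<in>I. \<forall>k\<in>I. i \<le> k \<longrightarrow> \<iota> k \<cdot>\<^bsub>C\<^esub> FArr G (i, k) = \<iota> i)"
  by (auto simp: cocone_def poset_cat_def)

lemma colimit_poset_cat_ex1:
  assumes "colimit (poset_cat I) C G c \<iota>" "cocone (poset_cat I) C G d \<kappa>"
  shows "\<exists>!h. h \<in> hom C c d \<and> (\<forall>i\<in>I. h \<cdot>\<^bsub>C\<^esub> \<iota> i = \<kappa> i)"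
proof -
  have "Obj (poset_cat I) = I" by (simp add: poset_cat_def)
  moreover have "\<exists>!h. h \<in> hom C c d \<and> (\<forall>i\<in>Obj (poset_cat I). h \<cdot>\<^bsub>C\<^esub> \<iota> i = \<kappa> i)"
    using assms unfolding colimit_def by blast
  ultimately show ?thesis by simp
qed

lemma functors_poset_catI:
  assumes "FObj G \<in> extensional I" "FArr G \<in> extensional (Arr (poset_cat I))"
    and "\<And>i. i \<in> I \<Longrightarrow> FObj G i \<in> Obj B"
    and "\<And>i k. i \<in> I \<Longrightarrow> k \<in> I \<Longrightarrow> i \<le> k \<Longrightarrow> FArr G (i, k) \<in> hom B (FObj G i) (FObj G k)"
    and "\<And>i. i \<in> I \<Longrightarrow> FArr G (i, i) = Ident B (FObj G i)"
    and "\<And>i k l. i \<in> I \<Longrightarrow> k \<in> I \<Longrightarrow> l \<in> I \<Longrightarrow> i \<le> k \<Longrightarrow> k \<le> l \<Longrightarrow>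
      FArr G (i, l) = FArr G (k, l) \<cdot>\<^bsub>B\<^esub> FArr G (i, k)"
  shows "G \<in> functors (poset_cat I) B"
proof -
  have "FArr G (i, k) \<in> Arr B" if "i \<in> I" "k \<in> I" "i \<le> k" for i k
    using assms(4)[OF that] by (simp add: hom_def)
  then show ?thesis
    using assms(1-5) assms(6)[symmetric] by (auto simp: functors_def PiE_def poset_cat_def)
qed

lemma functors_poset_catD:
  assumes "G \<in> functors (poset_cat I) B"
  shows "i \<in> I \<Longrightarrow> FObj G i \<in> Obj B"
    and "i \<in> I \<Longrightarrow> k \<in> I \<Longrightarrow> i \<le> k \<Longrightarrow> FArr G (i, k) \<in> hom B (FObj G i) (FObj G k)"
    and "i \<in> I \<Longrightarrow> k \<in> I \<Longrightarrow> l \<in> I \<Longrightarrow> i \<le> k \<Longrightarrow> k \<le> l \<Longrightarrow>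
      FArr G (k, l) \<cdot>\<^bsub>B\<^esub> FArr G (i, k) = FArr G (i, l)"
proof -
  show "i \<in> I \<Longrightarrow> FObj G i \<in> Obj B"
    using assms by (auto simp: functors_def poset_cat_def)
  have "\<forall>h\<in>Arr (poset_cat I). FArr G h \<in> hom B (FObj G (fst h)) (FObj G (snd h))"
    using assms by (simp add: functors_def poset_cat_def)
  then show "i \<in> I \<Longrightarrow> k \<in> I \<Longrightarrow> i \<le> k \<Longrightarrow> FArr G (i, k) \<in> hom B (FObj G i) (FObj G k)"
    by (auto simp: poset_cat_def)
  have "\<forall>p\<in>Arr (poset_cat I). \<forall>q\<in>Arr (poset_cat I). Dom (poset_cat I) q = Cod (poset_cat I) p \<longrightarrow>
      FArr G (q \<cdot>\<^bsub>poset_cat I\<^esub> p) = FArr G q \<cdot>\<^bsub>B\<^esub> FArr G p"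
    using assms unfolding functors_def by blast
  from this[rule_format, of "(i, k)" "(k, l)"]
  show "i \<in> I \<Longrightarrow> k \<in> I \<Longrightarrow> l \<in> I \<Longrightarrow> i \<le> k \<Longrightarrow> k \<le> l \<Longrightarrow>
      FArr G (k, l) \<cdot>\<^bsub>B\<^esub> FArr G (i, k) = FArr G (i, l)"
    by (simp add: poset_cat_def)
qed

section \<open>Construction of the stages by well-founded recursion\<close>

locale faithful_factorisation = category C
  for C :: "('o, 'm) cat" (structure) +
  fixes L R :: "'m set" and \<Phi> :: "('o, 'm) factor" and J :: "'j::order set"
  assumes finite_J: "finite J"
    and fact: "factorisation_system C L R \<Phi>"
    and faithful: "\<And>I. I \<subseteq> J \<Longrightarrow> (\<forall>i \<in> I. \<forall>j \<in> J. j \<le> i \<longrightarrow> j \<in> I) \<Longrightarrow> faithful_poset C L I"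
begin

abbreviation below :: "'j \<Rightarrow> 'j set" where
  "below j \<equiv> {i \<in> J. i < j}"

text \<open>A relation between the family \<open>f\<close>, read only below \<open>j\<close>, and an
  admissible value \<open>s\<close> at \<open>j\<close>; this is the shape that dependent
  well-founded choice expects. The colimit is quantified existentially, so no global choice of
  colimits has to be fixed first. There is no separate base case: at a minimal \<open>j\<close> the
  diagram is empty, \<open>c\<close> is an initial object, and \<open>h\<close> is the unique map
  from it to \<open>FObj X j\<close>.\<close>

definition is_stage :: "('j, 'j \<times> 'j, 'o, 'm) funct \<Rightarrow> ('j \<Rightarrow> ('j, 'o, 'm) stage)
    \<Rightarrow> 'j \<Rightarrow> ('j, 'o, 'm) stage \<Rightarrow> bool" where
  "is_stage X f j s \<longleftrightarrow> (\<exists>c \<iota> h.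
     colimit (poset_cat (below j)) C (stage_diagram C f (below j)) c \<iota> \<and>
     (\<forall>i\<in>below j. \<iota> i \<in> L) \<and>
     h \<in> hom C c (FObj X j) \<and> (\<forall>i\<in>below j. h \<cdot> \<iota> i = FArr X (i, j) \<cdot> proj (f i)) \<and>
     ob s = fact_F C \<Phi> h \<and> proj s = fact_R C \<Phi> h \<and>
     (\<forall>i\<in>below j. link s i = fact_L C \<Phi> h \<cdot> \<iota> i))"

text \<open>Finiteness of \<open>J\<close> enters here: a finite relation is well-founded once it is
  acyclic, and transitivity keeps the transitive closure inside the strict order.\<close>

lemma wf_below: "wf {(i, j). i \<in> J \<and> j \<in> J \<and> i < j}"
proof (rule finite_acyclic_wf)
  show "finite {(i, j). i \<in> J \<and> j \<in> J \<and> i < j}"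
    by (rule finite_subset[of _ "J \<times> J"]) (auto simp: finite_J)
  have "i < j" if "(i, j) \<in> {(i, j). i \<in> J \<and> j \<in> J \<and> i < j}\<^sup>+" for i j
    using that by (induction rule: trancl_induct) auto
  then show "acyclic {(i, j). i \<in> J \<and> j \<in> J \<and> i < j}"
    unfolding acyclic_def by blast
qed

lemma comp_in_L: "f \<in> L \<Longrightarrow> g \<in> L \<Longrightarrow> f \<in> hom C a b \<Longrightarrow> g \<in> hom C b c \<Longrightarrow> g \<cdot> f \<in> L"
  using fact by (auto simp: factorisation_system_def wide_class_def hom_def)

lemma Ident_in_L:
  assumes "a \<in> Obj C" shows "Ident C a \<in> L"
proof -
  have "iso C (Ident C a)"
    using Ident_hom[OF assms] Comp_Ident[OF Ident_hom[OF assms]] by (auto simp: iso_def hom_def)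
  then show ?thesis
    using fact by (auto simp: factorisation_system_def wide_class_def)
qed

lemma fact_hom:
  assumes "h \<in> hom C a b"
  shows "fact_L C \<Phi> h \<in> hom C a (fact_F C \<Phi> h)" "fact_R C \<Phi> h \<in> hom C (fact_F C \<Phi> h) b"
    "fact_R C \<Phi> h \<cdot> fact_L C \<Phi> h = h" "fact_L C \<Phi> h \<in> L" "fact_R C \<Phi> h \<in> R"
  using assms fact fact_L_R[OF category_axioms, of \<Phi> h]
  by (auto simp: factorisation_system_def hom_def)

text \<open>Beyond unfolding, this translates the cocone equations of \<open>\<iota>\<close> from
  arrows of \<open>stage_diagram\<close> to \<open>link\<close>, so that later arguments need not
  split off the diagonal.\<close>

lemma is_stageE:
  assumes "is_stage X f j s"
  obtains c \<iota> h where "colimit (poset_cat (below j)) C (stage_diagram C f (below j)) c \<iota>"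
    and "\<And>i. i \<in> J \<Longrightarrow> i < j \<Longrightarrow> \<iota> i \<in> L"
    and "\<And>i. i \<in> J \<Longrightarrow> i < j \<Longrightarrow> \<iota> i \<in> hom C (ob (f i)) c"
    and "\<And>i k. i \<in> J \<Longrightarrow> k \<in> J \<Longrightarrow> i < k \<Longrightarrow> k < j \<Longrightarrow> \<iota> k \<cdot> link (f k) i = \<iota> i"
    and "h \<in> hom C c (FObj X j)"
    and "\<And>i. i \<in> J \<Longrightarrow> i < j \<Longrightarrow> h \<cdot> \<iota> i = FArr X (i, j) \<cdot> proj (f i)"
    and "ob s = fact_F C \<Phi> h" "proj s = fact_R C \<Phi> h"
    and "\<And>i. i \<in> J \<Longrightarrow> i < j \<Longrightarrow> link s i = fact_L C \<Phi> h \<cdot> \<iota> i"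
proof -
  obtain c \<iota> h where *: "colimit (poset_cat (below j)) C (stage_diagram C f (below j)) c \<iota>"
    "\<forall>i\<in>below j. \<iota> i \<in> L"
    "h \<in> hom C c (FObj X j)" "\<forall>i\<in>below j. h \<cdot> \<iota> i = FArr X (i, j) \<cdot> proj (f i)"
    "ob s = fact_F C \<Phi> h" "proj s = fact_R C \<Phi> h"
    "\<forall>i\<in>below j. link s i = fact_L C \<Phi> h \<cdot> \<iota> i"
    using assms unfolding is_stage_def by blast
  have cc: "cocone (poset_cat (below j)) C (stage_diagram C f (below j)) c \<iota>"
    using *(1) by (simp add: colimit_def)
  have "\<iota> i \<in> hom C (ob (f i)) c" if "i \<in> J" "i < j" for i
    using cc that by (simp add: cocone_poset_cat stage_diagram_simps)
  moreover have "\<iota> k \<cdot> link (f k) i = \<iota> i" if "i \<in> J" "k \<in> J" "i < k" "k < j" for i k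
  proof -
    have ik: "i \<in> below j" "k \<in> below j" "i \<le> k" "i \<noteq> k" using that by auto
    then have "\<iota> k \<cdot> FArr (stage_diagram C f (below j)) (i, k) = \<iota> i"
      using cc unfolding cocone_poset_cat by blast
    then show ?thesis by (simp only: stage_diagram_simps(2)[OF ik(1-3)] ik(4) if_False)
  qed
  ultimately show thesis
    by (intro that[OF *(1) _ _ _ *(3) _ *(5,6)]) (use *(2,4,7) in auto)
qed

text \<open>Each link is a colimit inclusion followed by \<open>fact_L C \<Phi> h\<close>. Both lie
  in \<open>L\<close>, hence so does the link. Composing with \<open>fact_R C \<Phi> h\<close> gives
  back \<open>h\<close>, whose values on the inclusions yield compatibility with
  \<open>proj\<close>. The cocone equations of \<open>\<iota>\<close> survive composition with
  \<open>fact_L C \<Phi> h\<close>, which is the composition law for links.\<close>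

lemma stage_props:
  assumes "is_stage X f j (f j)"
  shows "ob (f j) \<in> Obj C" "proj (f j) \<in> hom C (ob (f j)) (FObj X j)" "proj (f j) \<in> R"
    and "\<And>i. i \<in> J \<Longrightarrow> i < j \<Longrightarrow> link (f j) i \<in> hom C (ob (f i)) (ob (f j))"
    and "\<And>i. i \<in> J \<Longrightarrow> i < j \<Longrightarrow> link (f j) i \<in> L"
    and "\<And>i. i \<in> J \<Longrightarrow> i < j \<Longrightarrow> proj (f j) \<cdot> link (f j) i = FArr X (i, j) \<cdot> proj (f i)"
    and "\<And>i k. i \<in> J \<Longrightarrow> k \<in> J \<Longrightarrow> i < k \<Longrightarrow> k < j \<Longrightarrow> is_stage X f k (f k) \<Longrightarrow>
      link (f j) k \<cdot> link (f k) i = link (f j) i"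
proof -
  obtain c \<iota> h where \<iota>L: "\<And>i. i \<in> J \<Longrightarrow> i < j \<Longrightarrow> \<iota> i \<in> L"
    and \<iota>: "\<And>i. i \<in> J \<Longrightarrow> i < j \<Longrightarrow> \<iota> i \<in> hom C (ob (f i)) c"
    and \<iota>t: "\<And>i k. i \<in> J \<Longrightarrow> k \<in> J \<Longrightarrow> i < k \<Longrightarrow> k < j \<Longrightarrow> \<iota> k \<cdot> link (f k) i = \<iota> i"
    and h: "h \<in> hom C c (FObj X j)"
    and h\<iota>: "\<And>i. i \<in> J \<Longrightarrow> i < j \<Longrightarrow> h \<cdot> \<iota> i = FArr X (i, j) \<cdot> proj (f i)"
    and s: "ob (f j) = fact_F C \<Phi> h" "proj (f j) = fact_R C \<Phi> h"
      "\<And>i. i \<in> J \<Longrightarrow> i < j \<Longrightarrow> link (f j) i = fact_L C \<Phi> h \<cdot> \<iota> i"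
    by (rule is_stageE[OF assms]) blast
  note fh = fact_hom[OF h]
  show "proj (f j) \<in> hom C (ob (f j)) (FObj X j)" "proj (f j) \<in> R"
    using fh s by simp_all
  then show "ob (f j) \<in> Obj C"
    using Dom_Obj[of "proj (f j)"] by (auto simp: hom_def)
  show "link (f j) i \<in> hom C (ob (f i)) (ob (f j))" if "i \<in> J" "i < j" for i
    using Comp_hom[OF \<iota>[OF that] fh(1)] s(1) s(3)[OF that] by simp
  show "link (f j) i \<in> L" if "i \<in> J" "i < j" for i
    using comp_in_L[OF \<iota>L[OF that] fh(4) \<iota>[OF that] fh(1)] s(3)[OF that] by simp
  show "proj (f j) \<cdot> link (f j) i = FArr X (i, j) \<cdot> proj (f i)" if "i \<in> J" "i < j" for i
    using Comp_assoc[OF \<iota>[OF that] fh(1,2)] fh(3) s(2) s(3)[OF that] h\<iota>[OF that] by simp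
  show "link (f j) k \<cdot> link (f k) i = link (f j) i"
    if ik: "i \<in> J" "k \<in> J" "i < k" "k < j" and st: "is_stage X f k (f k)" for i k
  proof -
    \<comment> \<open>Associativity needs \<open>link (f k) i\<close> to end at
      \<open>ob (f k)\<close>. The stage at \<open>j\<close> does not say so; the stage at
      \<open>k\<close> does.\<close>
    obtain a where "link (f k) i \<in> hom C a (ob (f k))"
    proof -
      obtain c' \<iota>' h' where "\<iota>' i \<in> hom C (ob (f i)) c'" "h' \<in> hom C c' (FObj X k)"
        "ob (f k) = fact_F C \<Phi> h'" "link (f k) i = fact_L C \<Phi> h' \<cdot> \<iota>' i"
        by (rule is_stageE[OF st]) (use ik in blast)
      then show thesis using that Comp_hom fact_hom(1) by metis
    qed
    then show ?thesis
      using Comp_assoc[OF _ \<iota>[OF ik(2,4)] fh(1)] s(3)[of k] s(3)[of i] ik \<iota>t by auto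
  qed
qed

text \<open>Chains with a repeated index reduce to identity laws, and strict chains are the
  composition law of \<open>stage_props\<close>. A general \<open>I\<close> is allowed because the
  lemma is applied to \<open>below j\<close> during the recursion and to \<open>J\<close> itself at
  the end.\<close>

lemma stage_diagram_functor:
  assumes "I \<subseteq> J" and st: "\<And>i. i \<in> I \<Longrightarrow> is_stage X f i (f i)"
  shows "stage_diagram C f I \<in> functors (poset_cat I) C"
    and "\<And>i k. i \<in> I \<Longrightarrow> k \<in> I \<Longrightarrow> i \<le> k \<Longrightarrow> FArr (stage_diagram C f I) (i, k) \<in> L"
proof -
  note sp = stage_props[OF st]
  have IJ: "i \<in> J" if "i \<in> I" for i using that assms by auto
  show L: "FArr (stage_diagram C f I) (i, k) \<in> L" if "i \<in> I" "k \<in> I" "i \<le> k" for i k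
    using that sp(1,5) IJ Ident_in_L by (auto simp: stage_diagram_simps order.order_iff_strict)
  have H: "(if i = k then Ident C (ob (f i)) else link (f k) i) \<in> hom C (ob (f i)) (ob (f k))"
    if "i \<in> I" "k \<in> I" "i \<le> k" for i k
    using that sp(1,4) IJ Ident_hom by (auto simp: order.order_iff_strict)
  show "stage_diagram C f I \<in> functors (poset_cat I) C"
  proof (rule functors_poset_catI)
    fix i k l assume ikl: "i \<in> I" "k \<in> I" "l \<in> I" "i \<le> k" "k \<le> l"
    then have "i \<le> l" by auto
    consider "i = k" | "k = l" | "i < k" "k < l" "i < l" using ikl by force
    then show "FArr (stage_diagram C f I) (i, l)
        = FArr (stage_diagram C f I) (k, l) \<cdot> FArr (stage_diagram C f I) (i, k)"
    proof cases
      case 1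
      then show ?thesis
        using ikl Comp_Ident[OF H[of k l]] by (simp add: stage_diagram_simps)
    next
      case 2
      then show ?thesis
        using ikl Ident_Comp[OF H[of i l]] by (simp add: stage_diagram_simps)
    next
      case 3
      moreover have "i \<noteq> k" "k \<noteq> l" "i \<noteq> l" using 3 by auto
      ultimately show ?thesis
        using ikl \<open>i \<le> l\<close> sp(7)[of l i k] IJ st by (simp add: stage_diagram_simps)
    qed
  next
    fix i k assume "i \<in> I" "k \<in> I" "i \<le> k"
    then show "FArr (stage_diagram C f I) (i, k)
        \<in> hom C (FObj (stage_diagram C f I) i) (FObj (stage_diagram C f I) k)"
      using H[of i k] by (simp only: stage_diagram_simps)
  qed (simp_all add: stage_diagram_simps sp(1), simp_all add: stage_diagram_def)
qed

text \<open>The recursion step. The partial diagram has all its arrows in \<open>L\<close>, so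
  faithfulness of \<open>below j\<close> gives a colimit with inclusions in \<open>L\<close>. The
  projections already built, continued by the arrows of \<open>X\<close> into
  \<open>FObj X j\<close>, form a cocone; the map it induces is the \<open>h\<close> to be
  factored.\<close>

lemma is_stage_exists:
  assumes X: "X \<in> functors (poset_cat J) C" and j: "j \<in> J"
    and st: "\<And>i. i \<in> J \<Longrightarrow> i < j \<Longrightarrow> is_stage X f i (f i)"
  shows "\<exists>s. is_stage X f j s"
proof -
  let ?I = "below j" and ?G = "stage_diagram C f (below j)"
  have st': "is_stage X f i (f i)" if "i \<in> ?I" for i using st that by simp
  have G: "?G \<in> functors (poset_cat ?I) C"
    "\<forall>i\<in>?I. \<forall>k\<in>?I. i \<le> k \<longrightarrow> FArr ?G (i, k) \<in> L"
    using stage_diagram_functor[of ?I X f] st' by auto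
  \<comment> \<open>\<open>below j\<close> is downward closed in \<open>J\<close> by transitivity of
    the order.\<close>
  have "faithful_poset C L ?I"
    by (rule faithful) auto
  then have fd: "faithful_diagram C L ?I ?G"
    using G unfolding faithful_poset_def by blast
  \<comment> \<open>Existence of this colimit is the first conjunct of
    \<open>faithful_diagram\<close>.\<close>
  then obtain c \<iota> where col: "colimit (poset_cat ?I) C ?G c \<iota>"
    unfolding faithful_diagram_def by (elim conjE exE)
  then have \<iota>L: "\<forall>i\<in>?I. \<iota> i \<in> L"
    using fd unfolding faithful_diagram_def by (elim conjE allE) (erule mp)
  note sp = stage_props[OF st]
  note XD = functors_poset_catD[OF X]
  define \<kappa> where "\<kappa> i = FArr X (i, j) \<cdot> proj (f i)" for i
  have \<kappa>: "\<kappa> i \<in> hom C (ob (f i)) (FObj X j)" if "i \<in> J" "i < j" for i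
    unfolding \<kappa>_def using Comp_hom[OF sp(2) XD(2)] that j by auto
  have "\<kappa> k \<cdot> link (f k) i = \<kappa> i" if ik: "i \<in> J" "k \<in> J" "i < k" "k < j" for i k
  proof -
    have ij: "i < j" using ik by auto
    have "\<kappa> k \<cdot> link (f k) i = FArr X (k, j) \<cdot> (FArr X (i, k) \<cdot> proj (f i))"
      using Comp_assoc[OF sp(4) sp(2) XD(2), of k i j] sp(6)[of k i] ik j by (simp add: \<kappa>_def)
    also have "\<dots> = (FArr X (k, j) \<cdot> FArr X (i, k)) \<cdot> proj (f i)"
      using Comp_assoc[OF sp(2) XD(2) XD(2), of i k j] ik ij j by simp
    also have "\<dots> = \<kappa> i"
      using XD(3)[of i k j] ik j by (simp add: \<kappa>_def)
    finally show ?thesis .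
  qed
  then have "cocone (poset_cat ?I) C ?G (FObj X j) \<kappa>"
    using \<kappa> Comp_Ident[OF \<kappa>] XD(1)[OF j]
    by (auto simp: cocone_poset_cat stage_diagram_simps)
  from colimit_poset_cat_ex1[OF col this]
  obtain h where "h \<in> hom C c (FObj X j)" "\<forall>i\<in>?I. h \<cdot> \<iota> i = \<kappa> i"
    by blast
  then have "is_stage X f j
      \<lparr>ob = fact_F C \<Phi> h, proj = fact_R C \<Phi> h, link = (\<lambda>i. fact_L C \<Phi> h \<cdot> \<iota> i)\<rparr>"
    unfolding is_stage_def using col \<iota>L
    by (intro exI[of _ c] exI[of _ \<iota>] exI[of _ h]) (simp add: \<kappa>_def)
  then show ?thesis ..
qed

text \<open>Dependent well-founded choice yields one family that satisfies its specification at
  every index relative to its own smaller values. Since the principle ranges over the whole type,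
  the specification is guarded by \<open>j \<in> J\<close>.\<close>

lemma stages_exist:
  assumes X: "X \<in> functors (poset_cat J) C"
  shows "\<exists>f. \<forall>j\<in>J. is_stage X f j (f j)"
proof -
  have "\<exists>f. \<forall>j. j \<in> J \<longrightarrow> is_stage X f j (f j)"
  proof (rule dependent_wf_choice[OF wf_below, of "\<lambda>f j s. j \<in> J \<longrightarrow> is_stage X f j s"])
    fix f g :: "'j \<Rightarrow> ('j, 'o, 'm) stage" and j s
    assume "\<And>i. (i, j) \<in> {(i, j). i \<in> J \<and> j \<in> J \<and> i < j} \<Longrightarrow> f i = g i"
    then have eq: "f i = g i" if "j \<in> J" "i \<in> below j" for i using that by simp
    show "(j \<in> J \<longrightarrow> is_stage X f j s) = (j \<in> J \<longrightarrow> is_stage X g j s)"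
    proof (cases "j \<in> J")
      case True
      then show ?thesis
        using stage_diagram_cong[of "below j" f g C, OF eq] eq
        by (simp add: is_stage_def cong: ball_cong_simp)
    qed simp
  qed (use is_stage_exists[OF X] in auto)
  then show ?thesis by blast
qed

section \<open>Lifting natural transformations along the recursion\<close>

text \<open>The maps \<open>\<beta>\<close> below \<open>j\<close> induce a map \<open>u\<close>
  between the two colimits. It forms a commutative square with \<open>h\<close>, \<open>h'\<close>
  and \<open>a j\<close>, and functoriality of the factorisation turns that square into
  \<open>b\<close>. The two families of stages are arbitrary: no compatibility between the colimits
  chosen for \<open>X\<close> and for \<open>Y\<close> is required.\<close>

lemma lift_step:
  assumes X: "X \<in> functors (poset_cat J) C" and Y: "Y \<in> functors (poset_cat J) C"
    and \<alpha>: "\<And>i. i \<in> J \<Longrightarrow> a i \<in> hom C (FObj X i) (FObj Y i)"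
    and \<alpha>_nat: "\<And>i k. i \<in> J \<Longrightarrow> k \<in> J \<Longrightarrow> i \<le> k \<Longrightarrow> a k \<cdot> FArr X (i, k) = FArr Y (i, k) \<cdot> a i"
    and f: "\<And>i. i \<in> J \<Longrightarrow> is_stage X f i (f i)"
    and g: "\<And>i. i \<in> J \<Longrightarrow> is_stage Y g i (g i)"
    and j: "j \<in> J"
    and \<beta>: "\<And>i. i \<in> J \<Longrightarrow> i < j \<Longrightarrow> \<beta> i \<in> hom C (ob (f i)) (ob (g i))"
    and \<beta>_proj: "\<And>i. i \<in> J \<Longrightarrow> i < j \<Longrightarrow> proj (g i) \<cdot> \<beta> i = a i \<cdot> proj (f i)"
    and \<beta>_nat: "\<And>i k. i \<in> J \<Longrightarrow> k \<in> J \<Longrightarrow> i < k \<Longrightarrow> k < j \<Longrightarrow>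
      \<beta> k \<cdot> link (f k) i = link (g k) i \<cdot> \<beta> i"
  obtains b where "b \<in> hom C (ob (f j)) (ob (g j))" "proj (g j) \<cdot> b = a j \<cdot> proj (f j)"
    "\<And>i. i \<in> J \<Longrightarrow> i < j \<Longrightarrow> b \<cdot> link (f j) i = link (g j) i \<cdot> \<beta> i"
proof -
  obtain c \<iota> h where col: "colimit (poset_cat (below j)) C (stage_diagram C f (below j)) c \<iota>"
    and \<iota>: "\<And>i. i \<in> J \<Longrightarrow> i < j \<Longrightarrow> \<iota> i \<in> hom C (ob (f i)) c"
    and \<iota>t: "\<And>i k. i \<in> J \<Longrightarrow> k \<in> J \<Longrightarrow> i < k \<Longrightarrow> k < j \<Longrightarrow> \<iota> k \<cdot> link (f k) i = \<iota> i"
    and h: "h \<in> hom C c (FObj X j)"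
    and h\<iota>: "\<And>i. i \<in> J \<Longrightarrow> i < j \<Longrightarrow> h \<cdot> \<iota> i = FArr X (i, j) \<cdot> proj (f i)"
    and s: "ob (f j) = fact_F C \<Phi> h" "proj (f j) = fact_R C \<Phi> h"
      "\<And>i. i \<in> J \<Longrightarrow> i < j \<Longrightarrow> link (f j) i = fact_L C \<Phi> h \<cdot> \<iota> i"
    by (rule is_stageE[OF f[OF j]]) blast
  obtain c' \<iota>' h' where \<iota>': "\<And>i. i \<in> J \<Longrightarrow> i < j \<Longrightarrow> \<iota>' i \<in> hom C (ob (g i)) c'"
    and \<iota>t': "\<And>i k. i \<in> J \<Longrightarrow> k \<in> J \<Longrightarrow> i < k \<Longrightarrow> k < j \<Longrightarrow> \<iota>' k \<cdot> link (g k) i = \<iota>' i"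
    and h': "h' \<in> hom C c' (FObj Y j)"
    and h\<iota>': "\<And>i. i \<in> J \<Longrightarrow> i < j \<Longrightarrow> h' \<cdot> \<iota>' i = FArr Y (i, j) \<cdot> proj (g i)"
    and s': "ob (g j) = fact_F C \<Phi> h'" "proj (g j) = fact_R C \<Phi> h'"
      "\<And>i. i \<in> J \<Longrightarrow> i < j \<Longrightarrow> link (g j) i = fact_L C \<Phi> h' \<cdot> \<iota>' i"
    by (rule is_stageE[OF g[OF j]]) blast
  note fp = stage_props[OF f] and gp = stage_props[OF g]
  note XD = functors_poset_catD[OF X] and YD = functors_poset_catD[OF Y]
  have c': "c' \<in> Obj C" using h' Dom_Obj[of h'] by (auto simp: hom_def)
  have coc: "cocone (poset_cat (below j)) C (stage_diagram C f (below j)) d \<kappa>"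
    if "d \<in> Obj C" and \<kappa>: "\<And>i. i \<in> J \<Longrightarrow> i < j \<Longrightarrow> \<kappa> i \<in> hom C (ob (f i)) d"
      and "\<And>i k. i \<in> J \<Longrightarrow> k \<in> J \<Longrightarrow> i < k \<Longrightarrow> k < j \<Longrightarrow> \<kappa> k \<cdot> link (f k) i = \<kappa> i"
    for d \<kappa>
    using that Comp_Ident[OF \<kappa>] by (auto simp: cocone_poset_cat stage_diagram_simps)
  \<comment> \<open>By \<open>\<beta>_nat\<close> the maps \<open>\<beta>\<close> form a
    transformation of partial diagrams, so following them by the inclusions \<open>\<iota>'\<close>
    gives a cocone on the first diagram.\<close>
  have "\<exists>!u. u \<in> hom C c c' \<and> (\<forall>i\<in>below j. u \<cdot> \<iota> i = \<iota>' i \<cdot> \<beta> i)"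
  proof -
    have "(\<iota>' k \<cdot> \<beta> k) \<cdot> link (f k) i = \<iota>' i \<cdot> \<beta> i" if ik: "i \<in> J" "k \<in> J" "i < k" "k < j" for i k
    proof -
      have ij: "i < j" using ik by auto
      show ?thesis
        using Comp_assoc[OF fp(4) \<beta> \<iota>', of k i] Comp_assoc[OF \<beta> gp(4) \<iota>', of i k] \<beta>_nat[of i k]
          \<iota>t'[of i k] ik ij by simp
    qed
    then have "cocone (poset_cat (below j)) C (stage_diagram C f (below j)) c' (\<lambda>i. \<iota>' i \<cdot> \<beta> i)"
      using coc[OF c'] Comp_hom[OF \<beta> \<iota>'] by simp
    then show ?thesis by (rule colimit_poset_cat_ex1[OF col])
  qed
  then obtain u where u: "u \<in> hom C c c'" and u\<iota>: "\<And>i. i \<in> J \<Longrightarrow> i < j \<Longrightarrow> u \<cdot> \<iota> i = \<iota>' i \<cdot> \<beta> i"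
    by blast
  have sq: "h' \<cdot> u = a j \<cdot> h"
  proof -
    \<comment> \<open>Both sides are maps out of the colimit \<open>c\<close>, so it suffices to
      compare them on the inclusions. The cocone is read off from the right-hand side, leaving only
      the left-hand side to be matched with it.\<close>
    define \<kappa> where "\<kappa> i = (a j \<cdot> h) \<cdot> \<iota> i" for i
    have ajh: "a j \<cdot> h \<in> hom C c (FObj Y j)" and h'u: "h' \<cdot> u \<in> hom C c (FObj Y j)"
      using Comp_hom[OF h \<alpha>[OF j]] Comp_hom[OF u h'] by auto
    have "cocone (poset_cat (below j)) C (stage_diagram C f (below j)) (FObj Y j) \<kappa>"
    proof (rule coc)
      show "FObj Y j \<in> Obj C" using YD(1) j by simp
      show "\<kappa> i \<in> hom C (ob (f i)) (FObj Y j)" if "i \<in> J" "i < j" for i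
        unfolding \<kappa>_def using Comp_hom[OF \<iota> ajh] that by simp
      show "\<kappa> k \<cdot> link (f k) i = \<kappa> i" if ik: "i \<in> J" "k \<in> J" "i < k" "k < j" for i k
        using Comp_assoc[OF fp(4) \<iota> ajh, of k i] ik \<iota>t by (simp add: \<kappa>_def)
    qed
    then have "\<exists>!q. q \<in> hom C c (FObj Y j) \<and> (\<forall>i\<in>below j. q \<cdot> \<iota> i = \<kappa> i)"
      by (rule colimit_poset_cat_ex1[OF col])
    \<comment> \<open>The path goes through \<open>\<iota>'\<close> to the projections of
      \<open>Y\<close>, crosses to \<open>X\<close> by \<open>\<beta>_proj\<close>, uses naturality
      of \<open>a\<close>, and returns to \<open>c\<close> through the values of \<open>h\<close> on
      the inclusions.\<close>
    moreover have "(h' \<cdot> u) \<cdot> \<iota> i = \<kappa> i" if "i \<in> below j" for i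
    proof -
      have ij: "i \<le> j" using that by auto
      have "(h' \<cdot> u) \<cdot> \<iota> i = h' \<cdot> (\<iota>' i \<cdot> \<beta> i)"
        using Comp_assoc[OF \<iota> u h'] u\<iota> that by simp
      also have "\<dots> = (FArr Y (i, j) \<cdot> proj (g i)) \<cdot> \<beta> i"
        using Comp_assoc[OF \<beta> \<iota>' h'] h\<iota>' that by simp
      also have "\<dots> = FArr Y (i, j) \<cdot> (a i \<cdot> proj (f i))"
        using Comp_assoc[OF \<beta> gp(2) YD(2)] \<beta>_proj that j ij by simp
      also have "\<dots> = (a j \<cdot> FArr X (i, j)) \<cdot> proj (f i)"
        using Comp_assoc[OF fp(2) \<alpha> YD(2)] \<alpha>_nat that j ij by simp
      also have "\<dots> = a j \<cdot> (h \<cdot> \<iota> i)"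
        using Comp_assoc[OF fp(2) XD(2) \<alpha>] h\<iota> that j ij by simp
      also have "\<dots> = \<kappa> i"
        using Comp_assoc[OF \<iota> h \<alpha>] that j by (simp add: \<kappa>_def)
      finally show ?thesis .
    qed
    moreover have "(a j \<cdot> h) \<cdot> \<iota> i = \<kappa> i" for i
      by (simp add: \<kappa>_def)
    ultimately show ?thesis
      using ajh h'u by blast
  qed
  have "functorial_factorisation C \<Phi>"
    using fact by (simp add: factorisation_system_def)
  from fact_square[OF category_axioms this h h' u \<alpha>[OF j] sq] obtain b
    where b: "b \<in> hom C (fact_F C \<Phi> h) (fact_F C \<Phi> h')"
      and bL: "b \<cdot> fact_L C \<Phi> h = fact_L C \<Phi> h' \<cdot> u"
      and bR: "fact_R C \<Phi> h' \<cdot> b = a j \<cdot> fact_R C \<Phi> h"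
    by blast
  show thesis
  proof (rule that[of b])
    \<comment> \<open>Both links factor through inclusions: \<open>bL\<close> moves \<open>b\<close>
      past the \<open>L\<close>-part, where it becomes \<open>u\<close>, and \<open>u\<iota>\<close>
      then turns \<open>u\<close> into \<open>\<beta> i\<close>.\<close>
    show "b \<cdot> link (f j) i = link (g j) i \<cdot> \<beta> i" if "i \<in> J" "i < j" for i
      using Comp_assoc[OF \<iota> fact_hom(1)[OF h] b, of i] Comp_assoc[OF \<iota> u fact_hom(1)[OF h'], of i]
        Comp_assoc[OF \<beta> \<iota>' fact_hom(1)[OF h'], of i] that s(3) s'(3) bL u\<iota> by simp
  qed (use b bR s s' in auto)
qed

text \<open>The same choice principle as for the stages. Compatibility with links is part of the
  specification at each index, so that the induction hypothesis delivers the naturality which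
  \<open>lift_step\<close> assumes below \<open>j\<close>.\<close>

lemma lift_exists:
  assumes X: "X \<in> functors (poset_cat J) C" and Y: "Y \<in> functors (poset_cat J) C"
    and \<alpha>: "\<And>i. i \<in> J \<Longrightarrow> a i \<in> hom C (FObj X i) (FObj Y i)"
    and \<alpha>_nat: "\<And>i k. i \<in> J \<Longrightarrow> k \<in> J \<Longrightarrow> i \<le> k \<Longrightarrow> a k \<cdot> FArr X (i, k) = FArr Y (i, k) \<cdot> a i"
    and f: "\<And>i. i \<in> J \<Longrightarrow> is_stage X f i (f i)"
    and g: "\<And>i. i \<in> J \<Longrightarrow> is_stage Y g i (g i)"
  shows "\<exists>\<beta>. \<forall>j\<in>J. \<beta> j \<in> hom C (ob (f j)) (ob (g j)) \<and> proj (g j) \<cdot> \<beta> j = a j \<cdot> proj (f j) \<and>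
    (\<forall>i\<in>below j. \<beta> j \<cdot> link (f j) i = link (g j) i \<cdot> \<beta> i)"
proof -
  let ?P = "\<lambda>\<beta> j b. j \<in> J \<longrightarrow> b \<in> hom C (ob (f j)) (ob (g j)) \<and> proj (g j) \<cdot> b = a j \<cdot> proj (f j) \<and>
    (\<forall>i\<in>below j. b \<cdot> link (f j) i = link (g j) i \<cdot> \<beta> i)"
  have "\<exists>\<beta>. \<forall>j. ?P \<beta> j (\<beta> j)"
  proof (rule dependent_wf_choice[OF wf_below, of ?P])
    fix \<beta> j
    assume IH: "\<And>i. (i, j) \<in> {(i, j). i \<in> J \<and> j \<in> J \<and> i < j} \<Longrightarrow> ?P \<beta> i (\<beta> i)"
    show "\<exists>b. ?P \<beta> j b"
    proof (cases "j \<in> J")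
      case True
      obtain b where "b \<in> hom C (ob (f j)) (ob (g j))" "proj (g j) \<cdot> b = a j \<cdot> proj (f j)"
        "\<And>i. i \<in> J \<Longrightarrow> i < j \<Longrightarrow> b \<cdot> link (f j) i = link (g j) i \<cdot> \<beta> i"
        by (rule lift_step[OF X Y \<alpha> \<alpha>_nat f g True, of \<beta>]) (use IH True in auto)
      then show ?thesis by auto
    qed simp
  qed auto
  then show ?thesis by blast
qed

section \<open>Assembling injectifications and lifted transformations\<close>

abbreviation "hat f \<equiv> stage_diagram C f J"

text \<open>The source is written as \<open>hat f\<close> itself;
  \<open>injectification_stages\<close> shows that this equals its composite with the inclusion of
  the wide subcategory.\<close>

definition counit :: "('j, 'j \<times> 'j, 'o, 'm) funct \<Rightarrow> ('j \<Rightarrow> ('j, 'o, 'm) stage)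
    \<Rightarrow> ('j, 'j \<times> 'j, 'o, 'm) nattrans" where
  "counit X f = \<lparr>Source = hat f, Target = X, Component = (\<lambda>j\<in>J. proj (f j))\<rparr>"

lemma nattrans_poset_catI:
  assumes "G \<in> functors (poset_cat J) C" "H \<in> functors (poset_cat J) C"
    and a: "\<And>j. j \<in> J \<Longrightarrow> a j \<in> hom C (FObj G j) (FObj H j)"
    and "\<And>i k. i \<in> J \<Longrightarrow> k \<in> J \<Longrightarrow> i \<le> k \<Longrightarrow> a k \<cdot> FArr G (i, k) = FArr H (i, k) \<cdot> a i"
  shows "\<lparr>Source = G, Target = H, Component = (\<lambda>j\<in>J. a j)\<rparr> \<in> hom (functor_cat (poset_cat J) C) G H"
proof -
  have "a j \<in> Arr C" if "j \<in> J" for j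
    using a[OF that] by (simp add: hom_def)
  then show ?thesis
    using assms by (auto simp: hom_functor_cat nattranses_def poset_cat_def)
qed

text \<open>The first claim is an equality of functors, not merely an isomorphism, because both
  sides are extensional and the inclusion acts as the identity on objects of \<open>C\<close> and on
  arrows in \<open>L\<close>. The second collects \<open>stage_props\<close> over all of
  \<open>J\<close>, with the diagonal case of naturality settled by identity laws.\<close>

lemma injectification_stages:
  assumes X: "X \<in> functors (poset_cat J) C" and st: "\<And>j. j \<in> J \<Longrightarrow> is_stage X f j (f j)"
  shows "comp_funct (poset_cat J) (inclusion C L) (hat f) = hat f"
    and "injectification (poset_cat J) C L R X (hat f) (counit X f)"
proof -
  note sp = stage_props[OF st]
  have F: "hat f \<in> functors (poset_cat J) C"
    and inL: "\<And>i k. i \<in> J \<Longrightarrow> k \<in> J \<Longrightarrow> i \<le> k \<Longrightarrow> FArr (hat f) (i, k) \<in> L"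
    using stage_diagram_functor[OF subset_refl st] by auto
  show eq: "comp_funct (poset_cat J) (inclusion C L) (hat f) = hat f"
  proof -
    have "(\<lambda>i\<in>J. FObj (inclusion C L) (FObj (hat f) i)) = FObj (hat f)"
      by (rule ext) (simp add: inclusion_def sp(1) stage_diagram_def)
    moreover have "(\<lambda>u\<in>Arr (poset_cat J). FArr (inclusion C L) (FArr (hat f) u)) = FArr (hat f)"
    proof
      fix u show "(\<lambda>u\<in>Arr (poset_cat J). FArr (inclusion C L) (FArr (hat f) u)) u = FArr (hat f) u"
      proof (cases "u \<in> Arr (poset_cat J)")
        case True
        then show ?thesis using inL by (auto simp: inclusion_def poset_cat_def)
      next
        case False
        then show ?thesis by (simp add: stage_diagram_def)
      qed
    qed
    ultimately show ?thesis
      by (simp add: comp_funct_def poset_cat_def)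
  qed
  have "hat f \<in> functors (poset_cat J) (wide_subcat C L)"
    using F inL by (intro functors_wide_subcat) (auto simp: poset_cat_def)
  moreover have "counit X f \<in> hom (functor_cat (poset_cat J) C) (hat f) X"
    unfolding counit_def
  proof (rule nattrans_poset_catI[OF F X])
    show "proj (f j) \<in> hom C (FObj (hat f) j) (FObj X j)" if "j \<in> J" for j
      using sp(2) that by (simp add: stage_diagram_simps)
    show "proj (f k) \<cdot> FArr (hat f) (i, k) = FArr X (i, k) \<cdot> proj (f i)"
      if "i \<in> J" "k \<in> J" "i \<le> k" for i k
    proof (cases "i = k")
      case True
      moreover have "FArr X (k, k) = Ident C (FObj X k)"
        using X that by (auto simp: functors_def poset_cat_def)
      ultimately show ?thesis
        using that Comp_Ident[OF sp(2)] Ident_Comp[OF sp(2)] by (simp add: stage_diagram_simps)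
    next
      case False
      then show ?thesis using that sp(6)[of k i] by (simp add: stage_diagram_simps)
    qed
  qed
  moreover have "Component (counit X f) j \<in> R" if "j \<in> J" for j
    using sp(3) that by (simp add: counit_def)
  ultimately show "injectification (poset_cat J) C L R X (hat f) (counit X f)"
    by (simp add: injectification_def eq) (simp add: poset_cat_def)
qed

text \<open>Compatibility with links gives naturality of the lifted family, and compatibility with
  projections is the required square, read componentwise.\<close>

lemma lift_nattrans:
  assumes X: "X \<in> functors (poset_cat J) C" and Y: "Y \<in> functors (poset_cat J) C"
    and \<alpha>: "\<alpha> \<in> hom (functor_cat (poset_cat J) C) X Y"
    and f: "\<And>i. i \<in> J \<Longrightarrow> is_stage X f i (f i)"
    and g: "\<And>i. i \<in> J \<Longrightarrow> is_stage Y g i (g i)"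
  shows "\<exists>\<alpha>' \<in> hom (functor_cat (poset_cat J) C) (hat f) (hat g).
    counit Y g \<cdot>\<^bsub>functor_cat (poset_cat J) C\<^esub> \<alpha>' = \<alpha> \<cdot>\<^bsub>functor_cat (poset_cat J) C\<^esub> counit X f"
proof -
  have \<alpha>': "\<alpha> \<in> nattranses (poset_cat J) C" "Source \<alpha> = X" "Target \<alpha> = Y"
    using \<alpha> by (auto simp: hom_functor_cat)
  have "Component \<alpha> i \<in> hom C (FObj X i) (FObj Y i)" if "i \<in> J" for i
    using \<alpha>' that by (auto simp: nattranses_def poset_cat_def)
  moreover have "Component \<alpha> k \<cdot> FArr X (i, k) = FArr Y (i, k) \<cdot> Component \<alpha> i"
    if "i \<in> J" "k \<in> J" "i \<le> k" for i k
  proof -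
    have "\<forall>u\<in>Arr (poset_cat J). Component \<alpha> (snd u) \<cdot> FArr X u = FArr Y u \<cdot> Component \<alpha> (fst u)"
      using \<alpha>' by (simp add: nattranses_def poset_cat_def)
    then show ?thesis using that by (auto simp: poset_cat_def)
  qed
  ultimately have "\<exists>\<beta>. \<forall>j\<in>J. \<beta> j \<in> hom C (ob (f j)) (ob (g j)) \<and>
      proj (g j) \<cdot> \<beta> j = Component \<alpha> j \<cdot> proj (f j) \<and>
      (\<forall>i\<in>below j. \<beta> j \<cdot> link (f j) i = link (g j) i \<cdot> \<beta> i)"
    by (rule lift_exists[OF X Y _ _ f g])
  then obtain \<beta> where \<beta>: "\<And>j. j \<in> J \<Longrightarrow> \<beta> j \<in> hom C (ob (f j)) (ob (g j))"
    and \<beta>_proj: "\<And>j. j \<in> J \<Longrightarrow> proj (g j) \<cdot> \<beta> j = Component \<alpha> j \<cdot> proj (f j)"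
    and \<beta>_nat: "\<And>i j. i \<in> J \<Longrightarrow> j \<in> J \<Longrightarrow> i < j \<Longrightarrow> \<beta> j \<cdot> link (f j) i = link (g j) i \<cdot> \<beta> i"
    by blast
  let ?\<beta> = "\<lparr>Source = hat f, Target = hat g, Component = (\<lambda>j\<in>J. \<beta> j)\<rparr>"
  have "?\<beta> \<in> hom (functor_cat (poset_cat J) C) (hat f) (hat g)"
    by (rule nattrans_poset_catI)
      (use stage_diagram_functor[OF subset_refl] f g \<beta> \<beta>_nat Comp_Ident[OF \<beta>] Ident_Comp[OF \<beta>]
        in \<open>auto simp: stage_diagram_simps\<close>)
  moreover have "counit Y g \<cdot>\<^bsub>functor_cat (poset_cat J) C\<^esub> ?\<beta>
      = \<alpha> \<cdot>\<^bsub>functor_cat (poset_cat J) C\<^esub> counit X f"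
    using \<alpha>'(3) \<beta>_proj by (auto simp: counit_def poset_cat_def intro!: restrict_ext)
  ultimately show ?thesis by blast
qed

end

theorem theorem13:
  fixes C :: "('o, 'm) cat" and L R :: "'m set" and \<Phi> :: "('o, 'm) factor"
    and J :: "'j::order set"
  assumes "finite J"
    and "category C"
    and "finitely_cocomplete C"
    and "factorisation_system C L R \<Phi>"
    and "\<And>I. I \<subseteq> J \<Longrightarrow> (\<forall>i \<in> I. \<forall>j \<in> J. j \<le> i \<longrightarrow> j \<in> I) \<Longrightarrow> faithful_poset C L I"
  shows "(\<forall>X \<in> functors (poset_cat J) C. \<exists>X' \<epsilon>. injectification (poset_cat J) C L R X X' \<epsilon>) \<and>
    (\<exists>hat eps.
       (\<forall>X \<in> functors (poset_cat J) C. injectification (poset_cat J) C L R X (hat X) (eps X)) \<and>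
       (\<forall>X \<in> functors (poset_cat J) C. \<forall>Y \<in> functors (poset_cat J) C.
          \<forall>\<alpha> \<in> hom (functor_cat (poset_cat J) C) X Y.
            \<exists>\<alpha>' \<in> hom (functor_cat (poset_cat J) C)
                    (comp_funct (poset_cat J) (inclusion C L) (hat X))
                    (comp_funct (poset_cat J) (inclusion C L) (hat Y)).
              eps Y \<cdot>\<^bsub>functor_cat (poset_cat J) C\<^esub> \<alpha>'
                = \<alpha> \<cdot>\<^bsub>functor_cat (poset_cat J) C\<^esub> eps X))"
proof -
  interpret faithful_factorisation C L R \<Phi> J
    using assms by (simp add: faithful_factorisation_def faithful_factorisation_axioms_def)
  \<comment> \<open>A family of stages is fixed for every diagram at once, before any transformation
    is considered; any two of these families admit lifts between them.\<close>
  obtain S where S: "\<And>X j. X \<in> functors (poset_cat J) C \<Longrightarrow> j \<in> J \<Longrightarrow> is_stage X (S X) j (S X j)"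
    using stages_exist by metis
  note inj = injectification_stages[OF _ S]
  show ?thesis
  proof (intro conjI)
    show "\<forall>X \<in> functors (poset_cat J) C. \<exists>X' \<epsilon>. injectification (poset_cat J) C L R X X' \<epsilon>"
      using inj(2) by blast
    show "\<exists>hat eps.
       (\<forall>X \<in> functors (poset_cat J) C. injectification (poset_cat J) C L R X (hat X) (eps X)) \<and>
       (\<forall>X \<in> functors (poset_cat J) C. \<forall>Y \<in> functors (poset_cat J) C.
          \<forall>\<alpha> \<in> hom (functor_cat (poset_cat J) C) X Y.
            \<exists>\<alpha>' \<in> hom (functor_cat (poset_cat J) C)
                    (comp_funct (poset_cat J) (inclusion C L) (hat X))
                    (comp_funct (poset_cat J) (inclusion C L) (hat Y)).
              eps Y \<cdot>\<^bsub>functor_cat (poset_cat J) C\<^esub> \<alpha>'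
                = \<alpha> \<cdot>\<^bsub>functor_cat (poset_cat J) C\<^esub> eps X)"
      \<comment> \<open>The composites with \<open>inclusion\<close> in the goal rewrite to
        \<open>hat (S X)\<close> and \<open>hat (S Y)\<close> by \<open>inj(1)\<close>, after which
        \<open>lift_nattrans\<close> applies.\<close>
      by (rule exI[of _ "\<lambda>X. hat (S X)"], rule exI[of _ "\<lambda>X. counit X (S X)"])
        (use inj lift_nattrans[OF _ _ _ S S] in simp)
  qed
qed

end
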